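(* Let $\mathcal{I}=(S,s_0,P,V)$ be an interval Markov chain, let $\alpha\subseteq A$ be a state label, let ${\sim}\in\{\le,<,>,\ge\}$ and let $0<p<1$. Then there exists a Markov chain $\mathcal{M}$ with $\mathcal{M}\models^{o}_{\mathtt{I}}\mathcal{I}$ and $\mathbb{P}^{\mathcal{M}}(\Diamond\alpha)\sim p$ if and only if there exists a Markov chain $\mathcal{M}$ with $\mathcal{M}\models^{a}_{\mathtt{I}}\mathcal{I}$ and $\mathbb{P}^{\mathcal{M}}(\Diamond\alpha)\sim p$. (That is, $\mathcal{I}$ satisfies the property $\mathbb{P}^{\mathcal{I}}(\Diamond\alpha)\sim p$ under the once-and-for-all semantics iff it satisfies it under the at-every-step semantics.)
   Context: Fix a set $A$ of atomic propositions. A Markov chain (MC) is a tuple $\mathcal{M}=(T,t_0,p,V^M)$ where $T$ is a finite set of states, $t_0\in T$ is the initial state, $V^M:T\to 2^A$ is a labelling function and $p:T\to\mathsf{Dist}(T)$ assigns to each state a probability distribution on $T$. $\mathcal{M}$ induces the usual probability measure on paths. For a label $\alpha\subseteq A$, $\mathbb{P}^{\mathcal{M}}(\Diamond\alpha)$ denotes the probability that a path starting in $t_0$ eventually visits a state $u$ with $V^M(u)=\alpha$. A state is reachable in $\mathcal{M}$ if it is visited with positive probability from $t_0$. An interval Markov chain (IMC) is a tuple $\mathcal{I}=(S,s_0,P,V^I)$ with $S$ a finite set of states, $s_0\in S$, $V^I:S\to 2^A$, and $P$ assigning to each pair $(s,s')\in S\times S$ an interval $P(s,s')\subseteq[0,1]$.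 Once-and-for-all semantics: $\mathcal{M}=(T,t_0,p,V^M)\models^{o}_{\mathtt{I}}\mathcal{I}$ iff $T=S$, $t_0=s_0$, $V^M=V^I$, and for every state $s$ reachable in $\mathcal{M}$ and every $s'\in S$, $p(s)(s')\in P(s,s')$. At-every-step semantics: $\mathcal{M}\models^{a}_{\mathtt{I}}\mathcal{I}$ iff there is a relation $\mathcal{R}\subseteq T\times S$ with $(t_0,s_0)\in\mathcal{R}$ such that whenever $(t,s)\in\mathcal{R}$: (1) $V^M(t)=V^I(s)$, and (2) there is a function $\delta:T\to(S\to[0,1])$ such that (a) for every $t'\in T$ with $p(t)(t')>0$, $\delta(t')$ is a probability distribution on $S$; (b) for every $s'\in S$, $\sum_{t'\in T}p(t)(t')\cdot\delta(t')(s')\in P(s,s')$; (c) for all $(t',s')\in T\times S$, if $\delta(t')(s')>0$ then $(t',s')\in\mathcal{R}$. *)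

theory Defs
  imports "HOL-Probability.Probability" "HOL-Library.Infinite_Typeclass"
begin

text \<open>
  The state space is a finite subset of the type \<open>'t\<close>. Existence of some finite Markov chain
  with a given property is expressed over a type \<open>'t :: infinite\<close>: every finite Markov chain is
  isomorphic to one whose states lie in such a type.
\<close>

record ('t, 'ap) mc =
  mc_states :: "'t set"
  mc_init :: 't
  mc_trans :: "'t \<Rightarrow> 't pmf"
  mc_label :: "'t \<Rightarrow> 'ap set"

definition markov_chain :: "'ap set \<Rightarrow> ('t, 'ap) mc \<Rightarrow> bool" where
  "markov_chain A M \<longleftrightarrow>
     finite (mc_states M) \<and> mc_init M \<in> mc_states M \<and>
     (\<forall>t\<in>mc_states M. set_pmf (mc_trans M t) \<subseteq> mc_states M) \<and>
     (\<forall>t\<in>mc_states M. mc_label M t \<subseteq> A)"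

text \<open>
  The measure on infinite paths is the Ionescu-Tulcea limit of the kernels
  ``position \<open>0\<close> is the initial state; position \<open>Suc n\<close> is drawn from the transition
  distribution of position \<open>n\<close>''. The lemma \<open>path_measure_cylinder\<close> below confirms that it
  has the expected values on cylinder sets.
\<close>

fun path_kernel :: "('t, 'ap) mc \<Rightarrow> nat \<Rightarrow> (nat \<Rightarrow> 't) \<Rightarrow> 't measure" where
  "path_kernel M 0 \<omega> = measure_pmf (return_pmf (mc_init M))"
| "path_kernel M (Suc n) \<omega> = measure_pmf (mc_trans M (\<omega> n))"

definition path_measure :: "('t, 'ap) mc \<Rightarrow> (nat \<Rightarrow> 't) measure" where
  "path_measure M =
     projective_family.lim UNIV
       (Ionescu_Tulcea.CI (path_kernel M) (\<lambda>_. count_space UNIV)) (\<lambda>_. count_space UNIV)"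

lemma Ionescu_Tulcea_path_kernel:
  "Ionescu_Tulcea (path_kernel M) (\<lambda>_. count_space UNIV)"
proof (rule Ionescu_Tulcea.intro)
  fix i
  show "path_kernel M i \<in> measurable (PiM {0..<i} (\<lambda>_. count_space UNIV))
          (subprob_algebra (count_space UNIV))"
  proof (cases i)
    case 0
    then show ?thesis
      by (simp add: path_kernel.simps[abs_def] measure_pmf_in_subprob_algebra)
  next
    case (Suc n)
    have "(\<lambda>\<omega>. measure_pmf (mc_trans M (\<omega> n)))
        \<in> measurable (PiM {0..<Suc n} (\<lambda>_. count_space UNIV)) (subprob_algebra (count_space UNIV))"
      by (rule measurable_compose[OF measurable_component_singleton[of n]])
         (auto simp: measure_pmf_in_subprob_algebra)
    then show ?thesis
      by (simp add: Suc path_kernel.simps[abs_def])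
  qed
next
  fix i \<omega>
  show "prob_space (path_kernel M i \<omega>)"
    by (cases i) (simp_all add: prob_space_measure_pmf)
qed

lemma path_measure_cylinder:
  "measure (path_measure M) {\<omega> \<in> space (path_measure M). \<forall>i\<le>n. \<omega> i = w i} =
     (if w 0 = mc_init M then \<Prod>i<n. pmf (mc_trans M (w i)) (w (Suc i)) else 0)"
proof -
  interpret Ionescu_Tulcea "path_kernel M" "\<lambda>_. count_space UNIV"
    by (rule Ionescu_Tulcea_path_kernel)
  let ?N = "\<lambda>_::nat. count_space (UNIV :: 'a set)"
  let ?X = "\<lambda>m. PiE {0..<m} (\<lambda>i. {w i})"
  let ?k = "\<lambda>i. emeasure (path_kernel M i w) {w i}"
  have X: "?X m \<in> sets (PiM {0..<m} ?N)" for m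
    by (intro sets_PiM_I_finite) auto
  have C: "emeasure (C 0 m (\<lambda>_. undefined)) (?X m) = (\<Prod>i<m. ?k i)" for m
  proof (induction m)
    case 0
    show ?case by (simp add: PiM_empty)
  next
    case (Suc m)
    have spC: "space (C 0 m (\<lambda>_. undefined)) = space (PiM {0..<m} ?N)"
      by (subst space_C) simp_all
    have setsC: "sets (C 0 m (\<lambda>_. undefined)) = sets (PiM {0..<m} ?N)"
      by (subst sets_C) simp_all
    have eP: "emeasure (eP m \<omega>) (?X (Suc m)) = ?k m * indicator (?X m) \<omega>"
      if \<omega>: "\<omega> \<in> space (PiM {0..<m} ?N)" for \<omega>
    proof (cases "\<omega> \<in> ?X m")
      case True
      then have "(\<lambda>x. fun_upd \<omega> m x) -` ?X (Suc m) = {w m}"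
        by (auto simp: PiE_iff extensional_def atLeast0_lessThan_Suc)
      moreover have "path_kernel M m \<omega> = path_kernel M m w"
        using True by (cases m) (auto simp: PiE_iff)
      ultimately show ?thesis
        using True by (simp add: emeasure_eP[OF \<omega> X])
    next
      case False
      then have "(\<lambda>x. fun_upd \<omega> m x) -` ?X (Suc m) = {}"
        using \<omega> by (auto simp: PiE_iff space_PiM atLeast0_lessThan_Suc split: if_splits)
      then show ?thesis
        using False by (simp add: emeasure_eP[OF \<omega> X])
    qed
    have meas: "eP m \<in> measurable (C 0 m (\<lambda>_. undefined)) (subprob_algebra (PiM {0..<Suc m} ?N))"
      using measurable_eP[of m] setsC by (simp cong: measurable_cong_sets)
    have "emeasure (C 0 (Suc m) (\<lambda>_. undefined)) (?X (Suc m)) =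
        (\<integral>\<^sup>+\<omega>. emeasure (eP m \<omega>) (?X (Suc m)) \<partial>C 0 m (\<lambda>_. undefined))"
      using emeasure_bind[OF _ meas X] by (simp add: spC)
    also have "\<dots> = (\<integral>\<^sup>+\<omega>. ?k m * indicator (?X m) \<omega> \<partial>C 0 m (\<lambda>_. undefined))"
      by (intro nn_integral_cong) (simp add: spC eP)
    also have "\<dots> = ?k m * emeasure (C 0 m (\<lambda>_. undefined)) (?X m)"
      using X[of m] setsC by (subst nn_integral_cmult_indicator) simp_all
    finally show ?case
      by (simp add: Suc mult.commute)
  qed
  have space: "space (path_measure M) = UNIV"
    by (simp add: path_measure_def PF.space_lim space_PiM)
  have emb: "{\<omega> \<in> space (path_measure M). \<forall>i\<le>n. \<omega> i = w i} = PF.emb UNIV {0..<Suc n} (?X (Suc n))"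
    by (auto simp: space prod_emb_def PiE_iff less_Suc_eq_le)
  have "emeasure (path_measure M) {\<omega> \<in> space (path_measure M). \<forall>i\<le>n. \<omega> i = w i} =
      emeasure (CI {0..<Suc n}) (?X (Suc n))"
    unfolding emb unfolding path_measure_def by (rule lim[OF _ X]) simp
  also have "\<dots> = emeasure (C 0 (Suc n) (\<lambda>_. undefined)) (PF.emb {0..<Suc n} {0..<Suc n} (?X (Suc n)))"
    by (rule emeasure_CI[OF _ X]) simp
  also have "PF.emb {0..<Suc n} {0..<Suc n} (?X (Suc n)) = ?X (Suc n)"
    by (rule prod_emb_id) auto
  also have "emeasure (C 0 (Suc n) (\<lambda>_. undefined)) (?X (Suc n)) = (\<Prod>i<Suc n. ?k i)"
    by (rule C)
  also have "\<dots> = ennreal (if w 0 = mc_init M then \<Prod>i<n. pmf (mc_trans M (w i)) (w (Suc i)) else 0)"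
    by (subst prod.lessThan_Suc_shift)
       (auto simp: emeasure_pmf_single prod_ennreal pmf_return simp del: return_pmf.rep_eq)
  finally show ?thesis
    by (auto simp: measure_def intro!: enn2real_ennreal prod_nonneg)
qed

definition prob_reach :: "('t, 'ap) mc \<Rightarrow> 'ap set \<Rightarrow> real" where
  "prob_reach M \<alpha> = \<P>(\<omega> in path_measure M. \<exists>n. mc_label M (\<omega> n) = \<alpha>)"

definition mc_reachable :: "('t, 'ap) mc \<Rightarrow> 't \<Rightarrow> bool" where
  "mc_reachable M t \<longleftrightarrow> \<P>(\<omega> in path_measure M. \<exists>n. \<omega> n = t) > 0"

text \<open>
  Transition intervals may be open, closed or half-open; \<open>is_interval\<close> also admits the empty set.
\<close>

record ('s, 'ap) imc =
  imc_states :: "'s set"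
  imc_init :: 's
  imc_trans :: "'s \<Rightarrow> 's \<Rightarrow> real set"
  imc_label :: "'s \<Rightarrow> 'ap set"

definition interval_markov_chain :: "'ap set \<Rightarrow> ('s, 'ap) imc \<Rightarrow> bool" where
  "interval_markov_chain A I \<longleftrightarrow>
     finite (imc_states I) \<and> imc_init I \<in> imc_states I \<and>
     (\<forall>s\<in>imc_states I. \<forall>s'\<in>imc_states I.
        is_interval (imc_trans I s s') \<and> imc_trans I s s' \<subseteq> {0..1}) \<and>
     (\<forall>s\<in>imc_states I. imc_label I s \<subseteq> A)"

definition sat_once :: "('s, 'ap) mc \<Rightarrow> ('s, 'ap) imc \<Rightarrow> bool" (infix "\<Turnstile>\<^sub>o" 50) where
  "M \<Turnstile>\<^sub>o I \<longleftrightarrow>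
     mc_states M = imc_states I \<and> mc_init M = imc_init I \<and>
     (\<forall>s\<in>imc_states I. mc_label M s = imc_label I s) \<and>
     (\<forall>s\<in>imc_states I. mc_reachable M s \<longrightarrow>
        (\<forall>s'\<in>imc_states I. pmf (mc_trans M s) s' \<in> imc_trans I s s'))"

definition sat_every :: "('t, 'ap) mc \<Rightarrow> ('s, 'ap) imc \<Rightarrow> bool" (infix "\<Turnstile>\<^sub>a" 50) where
  "M \<Turnstile>\<^sub>a I \<longleftrightarrow>
     (\<exists>R \<subseteq> mc_states M \<times> imc_states I. (mc_init M, imc_init I) \<in> R \<and>
        (\<forall>(t, s)\<in>R.
           mc_label M t = imc_label I s \<and>
           (\<exists>\<delta> \<in> mc_states M \<rightarrow> imc_states I \<rightarrow> {0..1::real}.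
              (\<forall>t'\<in>mc_states M. pmf (mc_trans M t) t' > 0 \<longrightarrow>
                 (\<Sum>s'\<in>imc_states I. \<delta> t' s') = 1) \<and>
              (\<forall>s'\<in>imc_states I.
                 (\<Sum>t'\<in>mc_states M. pmf (mc_trans M t) t' * \<delta> t' s') \<in> imc_trans I s s') \<and>
              (\<forall>t'\<in>mc_states M. \<forall>s'\<in>imc_states I. \<delta> t' s' > 0 \<longrightarrow> (t', s') \<in> R))))"

end

theory Submission
  imports Defs
begin

text \<open>
  A chain \<open>M\<close> satisfying \<open>I\<close> once and for all satisfies it at every step via the graph of a
  relabelling, restricted to the states reachable in the transition graph.

  Conversely, let \<open>N\<close> satisfy \<open>I\<close> at every step via \<open>R\<close>. For every \<open>s\<close> in the range of \<open>R\<close> select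
  one \<open>t\<close> with \<open>(t, s) \<in> R\<close> and give \<open>s\<close> the distribution \<open>s' \<mapsto> \<Sum>t'. p(t)(t') \<cdot> \<delta>(t')(s')\<close>; the
  resulting chain satisfies \<open>I\<close> once and for all. Selecting the \<open>t\<close> with the least probability of
  reaching \<open>\<alpha>\<close> gives a pre-fixed point of the reachability operator of the new chain, hence an
  upper bound on its reachability probability. Selecting the \<open>t\<close> with the greatest probability
  need not work, since the new chain may postpone reaching \<open>\<alpha>\<close> forever. With a discount \<open>c < 1\<close>
  per step the operator is a contraction and the argument goes through; finally \<open>c\<close> tends to \<open>1\<close>,
  where one of the finitely many selections is good for \<open>c\<close> arbitrarily close to \<open>1\<close>.
\<close>

section \<open>The path measure on finite prefixes\<close>

lemma space_path_measure [simp]: "space (path_measure M) = UNIV"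
proof -
  interpret Ionescu_Tulcea "path_kernel M" "\<lambda>_. count_space UNIV"
    by (rule Ionescu_Tulcea_path_kernel)
  show ?thesis by (simp add: path_measure_def PF.space_lim space_PiM)
qed

lemma sets_path_measure [measurable_cong]:
  "sets (path_measure M) = sets (PiM UNIV (\<lambda>_. count_space UNIV))"
proof -
  interpret Ionescu_Tulcea "path_kernel M" "\<lambda>_. count_space UNIV"
    by (rule Ionescu_Tulcea_path_kernel)
  show ?thesis by (simp add: path_measure_def PF.sets_lim)
qed

text \<open>The total mass of the limit is read off from its projection to the empty set of
  coordinates, where the projective family gives a probability measure.\<close>

lemma prob_space_path_measure: "prob_space (path_measure M)"
proof -
  interpret Ionescu_Tulcea "path_kernel M" "\<lambda>_. count_space UNIV"
    by (rule Ionescu_Tulcea_path_kernel)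
  have "(\<lambda>x. restrict x {}) \<in> measurable PF.lim (PiM {} (\<lambda>_. count_space UNIV))"
    by (simp add: measurable_cong_sets[OF PF.sets_lim refl] measurable_restrict_subset)
  moreover have "prob_space (distr PF.lim (PiM {} (\<lambda>_. count_space UNIV)) (\<lambda>x. restrict x {}))"
    by (simp add: distr_lim PF.prob_space_P)
  ultimately show ?thesis unfolding path_measure_def by (rule prob_space_distrD)
qed

lemma measurable_path_component [measurable]:
  "(\<lambda>\<omega>. \<omega> n) \<in> measurable (path_measure M) (count_space UNIV)"
  by measurable

lemma path_component_event: "{\<omega>. P (\<omega> n)} \<in> sets (path_measure M)"
  using measurable_sets[OF measurable_path_component[of n M], of "Collect P"] by (simp add: vimage_def)

lemma path_eventually_event: "{\<omega>. \<exists>n. P (\<omega> n)} \<in> sets (path_measure M)"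
proof -
  have "{\<omega>. \<exists>n. P (\<omega> n)} = (\<Union>n. {\<omega>. P (\<omega> n)})" by auto
  also have "\<dots> \<in> sets (path_measure M)"
    by (intro sets.countable_UN image_subsetI path_component_event)
  finally show ?thesis .
qed

section \<open>Weights of finite paths and events decided by a prefix\<close>

lemma sum_lists_length_Suc:
  "(\<Sum>xs | set xs \<subseteq> B \<and> length xs = Suc n. h xs) =
   (\<Sum>x\<in>B. \<Sum>xs | set xs \<subseteq> B \<and> length xs = n. h (x # xs))"
proof -
  have "inj_on (\<lambda>(xs, x). x # xs) ({xs. set xs \<subseteq> B \<and> length xs = n} \<times> B)"
    by (auto simp: inj_on_def)
  then have "(\<Sum>xs | set xs \<subseteq> B \<and> length xs = Suc n. h xs) =
      (\<Sum>(xs, x)\<in>{xs. set xs \<subseteq> B \<and> length xs = n} \<times> B. h (x # xs))"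
    by (simp add: lists_length_Suc_eq sum.reindex case_prod_unfold)
  also have "\<dots> = (\<Sum>xs | set xs \<subseteq> B \<and> length xs = n. \<Sum>x\<in>B. h (x # xs))"
    by (simp add: sum.cartesian_product)
  also have "\<dots> = (\<Sum>x\<in>B. \<Sum>xs | set xs \<subseteq> B \<and> length xs = n. h (x # xs))"
    by (rule sum.swap)
  finally show ?thesis .
qed

text \<open>The list is meant to have \<open>n + 1\<close> entries, the first being the starting
  state. No factor for the initial state occurs, so weights can be analysed by their first step from
  any state.\<close>

definition path_weight :: "('t, 'ap) mc \<Rightarrow> nat \<Rightarrow> 't list \<Rightarrow> real" where
  "path_weight M n xs = (\<Prod>i<n. pmf (mc_trans M (xs ! i)) (xs ! Suc i))"

lemma path_weight_Suc:
  "path_weight M (Suc n) (x # y # xs) = pmf (mc_trans M x) y * path_weight M n (y # xs)"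
  by (simp add: path_weight_def prod.lessThan_Suc_shift del: prod.lessThan_Suc)

text \<open>\<open>B\<close> may be smaller than the state set: besides \<open>mc_states M\<close>
  it is later the range of \<open>R\<close>, which a selected chain never leaves.\<close>

definition closed_in_mc :: "('t, 'ap) mc \<Rightarrow> 't set \<Rightarrow> bool" where
  "closed_in_mc M B \<longleftrightarrow> finite B \<and> (\<forall>t\<in>B. set_pmf (mc_trans M t) \<subseteq> B)"

lemma sum_pmf_closed: "closed_in_mc M B \<Longrightarrow> t \<in> B \<Longrightarrow> (\<Sum>t'\<in>B. pmf (mc_trans M t) t') = 1"
  by (rule sum_pmf_eq_1) (auto simp: closed_in_mc_def)

lemma sum_path_weight:
  assumes "closed_in_mc M B" "x \<in> B"
  shows "(\<Sum>xs | set xs \<subseteq> B \<and> length xs = n. path_weight M n (x # xs)) = 1"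
  using assms(2)
proof (induction n arbitrary: x)
  case 0
  have "{xs. set xs \<subseteq> B \<and> xs = []} = {[]}" by auto
  then show ?case by (simp add: path_weight_def)
next
  case (Suc n)
  have "(\<Sum>xs | set xs \<subseteq> B \<and> length xs = Suc n. path_weight M (Suc n) (x # xs)) =
      (\<Sum>y\<in>B. pmf (mc_trans M x) y * (\<Sum>xs | set xs \<subseteq> B \<and> length xs = n. path_weight M n (y # xs)))"
    by (simp add: sum_lists_length_Suc path_weight_Suc sum_distrib_left)
  also have "\<dots> = 1"
    using Suc sum_pmf_closed[OF assms(1)] by simp
  finally show ?case .
qed

text \<open>The cylinders of prefixes in \<open>B\<close> are disjoint and have total mass 1, so up
  to a null set \<open>E\<close> is the union of those cylinders whose prefix satisfies
  \<open>Q\<close>.\<close>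

lemma measure_path_prefix:
  assumes cl: "closed_in_mc M B" and init: "mc_init M \<in> B"
    and E: "E \<in> sets (path_measure M)"
    and Q: "\<And>\<omega>. \<omega> \<in> E \<longleftrightarrow> Q (map \<omega> [0..<Suc n])"
  shows "measure (path_measure M) E =
    (\<Sum>xs | set xs \<subseteq> B \<and> length xs = n. of_bool (Q (mc_init M # xs)) * path_weight M n (mc_init M # xs))"
proof -
  interpret prob_space "path_measure M" by (rule prob_space_path_measure)
  define L where "L = {xs. set xs \<subseteq> B \<and> length xs = n}"
  define cyl where "cyl xs = {\<omega>. \<forall>i\<le>n. \<omega> i = (mc_init M # xs) ! i}" for xs
  have finL: "finite L"
    using cl by (auto simp: L_def closed_in_mc_def intro: finite_lists_length_eq)
  have cyl_sets: "cyl xs \<in> sets (path_measure M)" for xs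
  proof -
    have "{\<omega> \<in> space (path_measure M). \<forall>i\<le>n. \<omega> i = (mc_init M # xs) ! i} \<in> sets (path_measure M)"
      by measurable
    then show ?thesis by (simp add: cyl_def)
  qed
  have prob_cyl: "prob (cyl xs) = path_weight M n (mc_init M # xs)" for xs
    using path_measure_cylinder[of M n "(!) (mc_init M # xs)"] by (simp add: cyl_def path_weight_def)
  have prefix: "map \<omega> [0..<Suc n] = mc_init M # xs" if "\<omega> \<in> cyl xs" "xs \<in> L" for \<omega> xs
    using that by (intro nth_equalityI) (auto simp: cyl_def L_def nth_append less_Suc_eq_le simp del: upt_Suc)
  have disj: "disjoint_family_on cyl X" if "X \<subseteq> L" for X
    using prefix that unfolding disjoint_family_on_def by (metis disjoint_iff list.inject subsetD)
  have union: "prob (\<Union>xs\<in>X. cyl xs) = (\<Sum>xs\<in>X. path_weight M n (mc_init M # xs))" if "X \<subseteq> L" for X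
    using finite_measure_finite_Union[of X cyl] disj[OF that] finL that cyl_sets
    by (auto simp: prob_cyl finite_subset)
  have "prob (\<Union>xs\<in>L. cyl xs) = 1"
    using sum_path_weight[OF cl init] by (simp add: union) (simp add: L_def)
  then have "AE \<omega> in path_measure M. \<omega> \<in> (\<Union>xs\<in>L. cyl xs)"
    using finL cyl_sets by (intro AE_prob_1) auto
  \<comment> \<open>Only almost sure equality is available here: \<open>E\<close> may also contain
    paths that leave \<open>B\<close> or start elsewhere.\<close>
  then have "prob E = prob (\<Union>xs\<in>{xs\<in>L. Q (mc_init M # xs)}. cyl xs)"
  proof (intro finite_measure_eq_AE, eventually_elim)
    case (elim \<omega>)
    then show ?case using Q prefix by auto metis+
  qed (use E finL cyl_sets in auto)
  also have "\<dots> = (\<Sum>xs\<in>L. of_bool (Q (mc_init M # xs)) * path_weight M n (mc_init M # xs))"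
    using finL by (subst union) (auto simp: of_bool_def sum.inter_filter if_distrib cong: if_cong intro!: sum.cong)
  finally show ?thesis by (simp add: L_def)
qed

lemma AE_path_closed:
  assumes cl: "closed_in_mc M B" and init: "mc_init M \<in> B"
  shows "AE \<omega> in path_measure M. \<forall>n. \<omega> n \<in> B"
  unfolding AE_all_countable
proof
  fix n
  interpret prob_space "path_measure M" by (rule prob_space_path_measure)
  have meas: "{\<omega>. \<omega> n \<in> B} \<in> sets (path_measure M)" by (rule path_component_event)
  have "prob {\<omega>. \<omega> n \<in> B} = (\<Sum>xs | set xs \<subseteq> B \<and> length xs = n.
      of_bool ((mc_init M # xs) ! n \<in> B) * path_weight M n (mc_init M # xs))"
    by (rule measure_path_prefix[OF cl init meas, where Q = "\<lambda>ys. ys ! n \<in> B"])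
       (simp del: upt_Suc)
  also have "\<dots> = (\<Sum>xs | set xs \<subseteq> B \<and> length xs = n. path_weight M n (mc_init M # xs))"
  proof (rule sum.cong)
    fix xs assume "xs \<in> {xs. set xs \<subseteq> B \<and> length xs = n}"
    then have "set (mc_init M # xs) \<subseteq> B" "n < length (mc_init M # xs)" using init by auto
    then have "(mc_init M # xs) ! n \<in> B" using nth_mem by blast
    then show "of_bool ((mc_init M # xs) ! n \<in> B) * path_weight M n (mc_init M # xs) =
      path_weight M n (mc_init M # xs)" by simp
  qed simp
  also have "\<dots> = 1" by (rule sum_path_weight[OF cl init])
  finally show "AE \<omega> in path_measure M. \<omega> n \<in> B"
    using AE_prob_1[of "{\<omega>. \<omega> n \<in> B}"] by simp
qed

section \<open>Discounted reachability values\<close>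

text \<open>For \<open>c = 1\<close> this is the probability of visiting \<open>\<alpha>\<close>
  within \<open>n\<close> steps. For \<open>c < 1\<close> the process is in addition killed with
  probability \<open>1 - c\<close> before each step.\<close>

fun hit :: "real \<Rightarrow> ('t, 'ap) mc \<Rightarrow> 'ap set \<Rightarrow> nat \<Rightarrow> 't \<Rightarrow> real" where
  "hit c M \<alpha> 0 t = of_bool (mc_label M t = \<alpha>)"
| "hit c M \<alpha> (Suc n) t =
     (if mc_label M t = \<alpha> then 1
      else c * (\<Sum>t'\<in>mc_states M. pmf (mc_trans M t) t' * hit c M \<alpha> n t'))"

text \<open>For \<open>0 \<le> c \<le> 1\<close> the sequence is increasing and bounded by 1 on
  \<open>mc_states M\<close>, so \<open>lim\<close> is a genuine limit there.\<close>

definition hit_val :: "real \<Rightarrow> ('t, 'ap) mc \<Rightarrow> 'ap set \<Rightarrow> 't \<Rightarrow> real" where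
  "hit_val c M \<alpha> t = lim (\<lambda>n. hit c M \<alpha> n t)"

locale finite_mc =
  fixes M :: "('t, 'ap) mc" and A :: "'ap set" and \<alpha> :: "'ap set" and c :: real
  assumes mc: "markov_chain A M" and c: "0 \<le> c" "c \<le> 1"
begin

lemma closed: "closed_in_mc M (mc_states M)"
  using mc by (simp add: markov_chain_def closed_in_mc_def)

lemma sum_pmf: "t \<in> mc_states M \<Longrightarrow> (\<Sum>t'\<in>mc_states M. pmf (mc_trans M t) t') = 1"
  by (rule sum_pmf_closed[OF closed])

lemma hit_nonneg: "0 \<le> hit c M \<alpha> n t"
  using c by (induction n arbitrary: t) (simp_all add: sum_nonneg)

lemma hit_le_1: "t \<in> mc_states M \<Longrightarrow> hit c M \<alpha> n t \<le> 1"
proof (induction n arbitrary: t)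
  case (Suc n)
  have "(\<Sum>t'\<in>mc_states M. pmf (mc_trans M t) t' * hit c M \<alpha> n t') \<le>
      (\<Sum>t'\<in>mc_states M. pmf (mc_trans M t) t' * 1)"
    using Suc by (intro sum_mono mult_left_mono) auto
  also have "\<dots> = 1" using sum_pmf Suc by simp
  finally show ?case
    using c by (auto intro!: mult_le_one sum_nonneg mult_nonneg_nonneg hit_nonneg)
qed simp

lemma hit_mono_Suc: "t \<in> mc_states M \<Longrightarrow> hit c M \<alpha> n t \<le> hit c M \<alpha> (Suc n) t"
proof (induction n arbitrary: t)
  case 0
  then show ?case using c by (simp add: sum_nonneg)
next
  case (Suc n)
  then show ?case
    using c by (auto simp del: hit.simps(2) simp: hit.simps(2)[of _ _ _ "Suc n"] hit.simps(2)[of _ _ _ n]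
      intro!: mult_left_mono sum_mono)
qed

lemma hit_tendsto: "t \<in> mc_states M \<Longrightarrow> (\<lambda>n. hit c M \<alpha> n t) \<longlonglongrightarrow> hit_val c M \<alpha> t"
proof -
  assume t: "t \<in> mc_states M"
  have "convergent (\<lambda>n. hit c M \<alpha> n t)"
    by (rule Bseq_mono_convergent)
       (use t hit_nonneg hit_le_1 in \<open>auto intro!: BseqI'[of _ 1] lift_Suc_mono_le[of "\<lambda>n. hit c M \<alpha> n t"] hit_mono_Suc\<close>)
  then show ?thesis by (simp add: hit_val_def convergent_LIMSEQ_iff)
qed

lemma hit_le_val: "t \<in> mc_states M \<Longrightarrow> hit c M \<alpha> n t \<le> hit_val c M \<alpha> t"
  by (rule incseq_le[OF incseq_SucI hit_tendsto]) (auto simp del: hit.simps intro: hit_mono_Suc)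

lemma val_le_1: "t \<in> mc_states M \<Longrightarrow> hit_val c M \<alpha> t \<le> 1"
  by (rule LIMSEQ_le_const2[OF hit_tendsto]) (auto intro: hit_le_1)

lemma val_nonneg: "t \<in> mc_states M \<Longrightarrow> 0 \<le> hit_val c M \<alpha> t"
  using hit_le_val hit_nonneg order_trans by metis

lemma val_fixed_point:
  assumes t: "t \<in> mc_states M"
  shows "hit_val c M \<alpha> t =
     (if mc_label M t = \<alpha> then 1
      else c * (\<Sum>t'\<in>mc_states M. pmf (mc_trans M t) t' * hit_val c M \<alpha> t'))"
proof -
  have "(\<lambda>n. hit c M \<alpha> (Suc n) t) \<longlonglongrightarrow> 
     (if mc_label M t = \<alpha> then 1
      else c * (\<Sum>t'\<in>mc_states M. pmf (mc_trans M t) t' * hit_val c M \<alpha> t'))"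
    by (auto intro!: tendsto_intros hit_tendsto)
  with LIMSEQ_Suc[OF hit_tendsto[OF t]] show ?thesis by (rule LIMSEQ_unique)
qed

text \<open>By induction every iterate \<open>hit\<close> stays below \<open>V\<close>, and so does
  the limit: the value is the least fixed point. This works for \<open>c = 1\<close> too.\<close>

lemma val_le_pre_fixed_point:
  assumes B: "closed_in_mc M B" "B \<subseteq> mc_states M" "t \<in> B"
    and nonneg: "\<And>s. s \<in> B \<Longrightarrow> 0 \<le> V s"
    and target: "\<And>s. s \<in> B \<Longrightarrow> mc_label M s = \<alpha> \<Longrightarrow> 1 \<le> V s"
    and step: "\<And>s. s \<in> B \<Longrightarrow> mc_label M s \<noteq> \<alpha> \<Longrightarrow> c * (\<Sum>s'\<in>B. pmf (mc_trans M s) s' * V s') \<le> V s"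
  shows "hit_val c M \<alpha> t \<le> V t"
proof -
  have "hit c M \<alpha> n s \<le> V s" if "s \<in> B" for n s
    using that
  proof (induction n arbitrary: s)
    case 0 then show ?case using nonneg target by auto
  next
    case (Suc n)
    have "(\<Sum>s'\<in>mc_states M. pmf (mc_trans M s) s' * hit c M \<alpha> n s') = 
       (\<Sum>s'\<in>B. pmf (mc_trans M s) s' * hit c M \<alpha> n s')"
      using B Suc.prems closed by (intro sum.mono_neutral_right) (auto simp: closed_in_mc_def pmf_eq_0_set_pmf)
    also have "\<dots> \<le> (\<Sum>s'\<in>B. pmf (mc_trans M s) s' * V s')"
      using Suc by (intro sum_mono mult_left_mono) auto
    finally have "c * (\<Sum>s'\<in>mc_states M. pmf (mc_trans M s) s' * hit c M \<alpha> n s') \<le> c * \<dots>"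
      using c by (intro mult_left_mono) auto
    then show ?case using target step Suc.prems by fastforce
  qed
  then show ?thesis
    using B by (intro LIMSEQ_le_const2[OF hit_tendsto]) auto
qed

text \<open>\<open>V\<close> exceeds the \<open>n\<close>-th iterate by at most
  \<open>c ^ n\<close>, which vanishes because \<open>c < 1\<close>. For \<open>c = 1\<close> the
  claim fails: on a loop that avoids \<open>\<alpha>\<close> the constant 1 is a post-fixed point,
  while the value is 0.\<close>

lemma val_ge_post_fixed_point:
  assumes B: "closed_in_mc M B" "B \<subseteq> mc_states M" "t \<in> B" and c1: "c < 1"
    and le_1: "\<And>s. s \<in> B \<Longrightarrow> V s \<le> 1"
    and step: "\<And>s. s \<in> B \<Longrightarrow> mc_label M s \<noteq> \<alpha> \<Longrightarrow> V s \<le> c * (\<Sum>s'\<in>B. pmf (mc_trans M s) s' * V s')"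
  shows "V t \<le> hit_val c M \<alpha> t"
proof -
  have le: "V s \<le> hit c M \<alpha> n s + c ^ n" if "s \<in> B" for n s
    using that
  proof (induction n arbitrary: s)
    case 0 then show ?case using le_1[of s] by auto
  next
    case (Suc n)
    show ?case
    proof (cases "mc_label M s = \<alpha>")
      case True
      then show ?thesis using le_1[OF Suc.prems] c by (simp add: add_increasing2)
    next
      case False
      have "(\<Sum>s'\<in>B. pmf (mc_trans M s) s' * V s') \<le>
          (\<Sum>s'\<in>B. pmf (mc_trans M s) s' * (hit c M \<alpha> n s' + c ^ n))"
        using Suc by (intro sum_mono mult_left_mono) auto
      also have "\<dots> = (\<Sum>s'\<in>B. pmf (mc_trans M s) s' * hit c M \<alpha> n s') + c ^ n"
        using sum_pmf_closed[OF B(1) Suc.prems]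
        by (simp add: distrib_left sum.distrib flip: sum_distrib_right)
      also have "(\<Sum>s'\<in>B. pmf (mc_trans M s) s' * hit c M \<alpha> n s') =
          (\<Sum>s'\<in>mc_states M. pmf (mc_trans M s) s' * hit c M \<alpha> n s')"
        using B Suc.prems closed by (intro sum.mono_neutral_left) (auto simp: closed_in_mc_def pmf_eq_0_set_pmf)
      finally have "c * (\<Sum>s'\<in>B. pmf (mc_trans M s) s' * V s') \<le>
          c * ((\<Sum>s'\<in>mc_states M. pmf (mc_trans M s) s' * hit c M \<alpha> n s') + c ^ n)"
        using c by (intro mult_left_mono) auto
      with step[OF Suc.prems False] False show ?thesis by (simp add: distrib_left)
    qed
  qed
  have "(\<lambda>n. hit c M \<alpha> n t + c ^ n) \<longlonglongrightarrow> hit_val c M \<alpha> t + 0"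
    using B c c1 by (intro tendsto_intros hit_tendsto LIMSEQ_realpow_zero) auto
  then show ?thesis
    using le[OF \<open>t \<in> B\<close>] by (intro LIMSEQ_le_const[of _ _ "V t"]) auto
qed

text \<open>A first visit at step \<open>k \<le> n\<close> is discounted by \<open>c ^ k\<close>,
  which is at least \<open>c ^ n\<close>.\<close>

lemma hit_discount: "t \<in> mc_states M \<Longrightarrow> c ^ n * hit 1 M \<alpha> n t \<le> hit c M \<alpha> n t"
proof (induction n arbitrary: t)
  case (Suc n)
  have "c ^ n * (\<Sum>t'\<in>mc_states M. pmf (mc_trans M t) t' * hit 1 M \<alpha> n t') =
     (\<Sum>t'\<in>mc_states M. pmf (mc_trans M t) t' * (c ^ n * hit 1 M \<alpha> n t'))"
    by (simp add: sum_distrib_left mult_ac)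
  also have "\<dots> \<le> (\<Sum>t'\<in>mc_states M. pmf (mc_trans M t) t' * hit c M \<alpha> n t')"
    using Suc by (intro sum_mono mult_left_mono) auto
  finally have "c * (c ^ n * (\<Sum>t'\<in>mc_states M. pmf (mc_trans M t) t' * hit 1 M \<alpha> n t')) \<le> c * \<dots>"
    using c by (intro mult_left_mono) auto
  then show ?case using c power_le_one[of c "Suc n"] by (auto simp: mult_ac)
qed simp

text \<open>The undiscounted value is a pre-fixed point of the discounted operator.\<close>

lemma val_discount_le: "t \<in> mc_states M \<Longrightarrow> hit_val c M \<alpha> t \<le> hit_val 1 M \<alpha> t"
proof -
  assume t: "t \<in> mc_states M"
  interpret one: finite_mc M A \<alpha> 1 by unfold_locales (use mc in auto)
  have "c * (\<Sum>s'\<in>mc_states M. pmf (mc_trans M s) s' * hit_val 1 M \<alpha> s') \<le> hit_val 1 M \<alpha> s"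
    if "s \<in> mc_states M" "mc_label M s \<noteq> \<alpha>" for s
    using one.val_fixed_point[OF that(1)] that one.val_nonneg[OF that(1)] c
    by (simp add: mult_left_le_one_le)
  moreover have "1 \<le> hit_val 1 M \<alpha> s" if "s \<in> mc_states M" "mc_label M s = \<alpha>" for s
    using that by (subst one.val_fixed_point) auto
  ultimately show ?thesis
    using t by (intro val_le_pre_fixed_point[OF closed]) (auto intro: one.val_nonneg)
qed

end

text \<open>Reaching \<open>\<alpha>\<close> is the increasing union of the events of reaching it
  within \<open>n\<close> steps, whose probabilities are the iterates \<open>hit\<close>. From here
  on no argument about reachability probabilities touches the path measure.\<close>

lemma prob_reach_eq_val:
  fixes M :: "('t, 'ap) mc"
  assumes "markov_chain A M"
  shows "prob_reach M \<alpha> = hit_val 1 M \<alpha> (mc_init M)"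
proof -
  interpret finite_mc M A \<alpha> 1 by unfold_locales (use assms in auto)
  interpret prob_space "path_measure M" by (rule prob_space_path_measure)
  have init: "mc_init M \<in> mc_states M" using assms by (simp add: markov_chain_def)
  define E where "E n = {\<omega> :: nat \<Rightarrow> 't. \<exists>i\<le>n. mc_label M (\<omega> i) = \<alpha>}" for n
  have E_sets: "E n \<in> sets (path_measure M)" for n
  proof -
    have "E n = (\<Union>i\<le>n. {\<omega>. mc_label M (\<omega> i) = \<alpha>})" by (auto simp: E_def)
    then show ?thesis by (auto intro: path_component_event)
  qed
  \<comment> \<open>The starting state is arbitrary so that the induction can pass from
    \<open>t\<close> to its successors.\<close>
  have hit: "(\<Sum>xs | set xs \<subseteq> mc_states M \<and> length xs = n.
      of_bool (\<exists>y\<in>set (t # xs). mc_label M y = \<alpha>) * path_weight M n (t # xs)) = hit 1 M \<alpha> n t"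
    if "t \<in> mc_states M" for n t
    using that
  proof (induction n arbitrary: t)
    case 0
    have "{xs. set xs \<subseteq> mc_states M \<and> xs = []} = {[]}" by auto
    then show ?case by (simp add: path_weight_def)
  next
    case (Suc n)
    show ?case
    proof (cases "mc_label M t = \<alpha>")
      case True
      \<comment> \<open>Every prefix from \<open>t\<close> counts, and the weights sum to 1.\<close>
      then show ?thesis using sum_path_weight[OF closed Suc.prems, of "Suc n"] by simp
    next
      case False
      then have "(\<Sum>xs | set xs \<subseteq> mc_states M \<and> length xs = Suc n.
          of_bool (\<exists>y\<in>set (t # xs). mc_label M y = \<alpha>) * path_weight M (Suc n) (t # xs)) =
        (\<Sum>y\<in>mc_states M. pmf (mc_trans M t) y * (\<Sum>xs | set xs \<subseteq> mc_states M \<and> length xs = n.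
          of_bool (\<exists>z\<in>set (y # xs). mc_label M z = \<alpha>) * path_weight M n (y # xs)))"
        by (simp add: sum_lists_length_Suc path_weight_Suc sum_distrib_left mult_ac)
      with False Suc.IH show ?thesis by simp
    qed
  qed
  have "prob (E n) = hit 1 M \<alpha> n (mc_init M)" for n
    unfolding hit[OF init, symmetric]
    by (rule measure_path_prefix[OF closed init E_sets]) (auto simp: E_def less_Suc_eq_le simp del: upt_Suc)
  moreover have "(\<lambda>n. prob (E n)) \<longlonglongrightarrow> prob (\<Union>n. E n)"
  proof (rule finite_Lim_measure_incseq)
    show "range E \<subseteq> events" using E_sets by auto
    show "incseq E" by (auto simp: incseq_def E_def intro: order_trans)
  qed
  moreover have "(\<Union>n. E n) = {\<omega>. \<exists>n. mc_label M (\<omega> n) = \<alpha>}"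
    by (auto simp: E_def)
  ultimately show ?thesis
    using hit_tendsto[OF init] LIMSEQ_unique by (fastforce simp: prob_reach_def)
qed

section \<open>Reachable states\<close>

definition step_rel :: "('t, 'ap) mc \<Rightarrow> 't rel" where
  "step_rel M = {(t, t'). t' \<in> set_pmf (mc_trans M t)}"

text \<open>A walk in the transition graph determines a cylinder of positive measure.\<close>

lemma mc_reachable_if_rtrancl:
  assumes "(mc_init M, t) \<in> (step_rel M)\<^sup>*"
  shows "mc_reachable M t"
proof -
  interpret prob_space "path_measure M" by (rule prob_space_path_measure)
  obtain n where "(mc_init M, t) \<in> step_rel M ^^ n"
    using assms by (auto simp: rtrancl_power)
  then obtain w where w: "w 0 = mc_init M" "w n = t" "\<And>i. i < n \<Longrightarrow> (w i, w (Suc i)) \<in> step_rel M"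
    by (auto simp: relpow_fun_conv)
  have "0 < (\<Prod>i<n. pmf (mc_trans M (w i)) (w (Suc i)))"
    using w(3) by (intro prod_pos) (auto simp: step_rel_def pmf_positive)
  also have "\<dots> = prob {\<omega> \<in> space (path_measure M). \<forall>i\<le>n. \<omega> i = w i}"
    using w(1) by (simp only: path_measure_cylinder) simp
  also have "\<dots> \<le> prob {\<omega> \<in> space (path_measure M). \<exists>n. \<omega> n = t}"
    using w(2) by (intro finite_measure_mono) (auto intro: path_eventually_event)
  finally show ?thesis by (simp add: mc_reachable_def)
qed

text \<open>Almost every path stays in \<open>B\<close>, so a state outside \<open>B\<close> is
  visited with probability zero.\<close>

lemma mc_reachable_in_closed:
  assumes "mc_reachable M t" "closed_in_mc M B" "mc_init M \<in> B"
  shows "t \<in> B"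
proof (rule ccontr)
  assume "t \<notin> B"
  interpret prob_space "path_measure M" by (rule prob_space_path_measure)
  have "AE \<omega> in path_measure M. \<not> (\<exists>n. \<omega> n = t)"
    by (rule AE_mp[OF AE_path_closed[OF assms(2,3)]]) (use \<open>t \<notin> B\<close> in auto)
  then have "prob {\<omega> \<in> space (path_measure M). \<exists>n. \<omega> n = t} = 0"
    by (subst prob_eq_0) (auto intro: path_eventually_event)
  with assms(1) show False by (simp add: mc_reachable_def)
qed


section \<open>From once-and-for-all to at-every-step\<close>

text \<open>This moves a chain from the state type of the interval chain to the other state type.
  Off the image of the state set \<open>inv_into\<close> is unspecified, which does no harm.\<close>

definition relabel_mc :: "('s \<Rightarrow> 't) \<Rightarrow> ('s, 'ap) mc \<Rightarrow> ('t, 'ap) mc" where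
  "relabel_mc f M =
     \<lparr>mc_states = f ` mc_states M, mc_init = f (mc_init M),
      mc_trans = (\<lambda>u. map_pmf f (mc_trans M (inv_into (mc_states M) f u))),
      mc_label = (\<lambda>u. mc_label M (inv_into (mc_states M) f u))\<rparr>"

locale relabelling =
  fixes M :: "('s, 'ap) mc" and f :: "'s \<Rightarrow> 't" and A :: "'ap set"
  assumes mc: "markov_chain A M" and inj: "inj_on f (mc_states M)"
begin

lemma simps:
  "mc_states (relabel_mc f M) = f ` mc_states M"
  "mc_init (relabel_mc f M) = f (mc_init M)"
  "t \<in> mc_states M \<Longrightarrow> mc_trans (relabel_mc f M) (f t) = map_pmf f (mc_trans M t)"
  "t \<in> mc_states M \<Longrightarrow> mc_label (relabel_mc f M) (f t) = mc_label M t"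
  using inj by (simp_all add: relabel_mc_def)

lemma markov_chain_relabel: "markov_chain A (relabel_mc f M)"
  using mc by (auto simp: markov_chain_def simps)

text \<open>Injectivity holds only on the state set, so a target outside the support needs its own
  argument.\<close>

lemma pmf_relabel:
  assumes "t \<in> mc_states M" "t' \<in> mc_states M"
  shows "pmf (map_pmf f (mc_trans M t)) (f t') = pmf (mc_trans M t) t'"
proof -
  have sub: "set_pmf (mc_trans M t) \<subseteq> mc_states M" using mc assms by (auto simp: markov_chain_def)
  show ?thesis
  proof (cases "t' \<in> set_pmf (mc_trans M t)")
    case True
    with inj sub show ?thesis by (simp add: pmf_map_inj inj_on_subset)
  next
    case False
    then have "f t' \<notin> set_pmf (map_pmf f (mc_trans M t))"
      using inj sub assms by (auto dest: inj_onD)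
    with False show ?thesis by (metis pmf_eq_0_set_pmf)
  qed
qed

lemma hit_relabel: "t \<in> mc_states M \<Longrightarrow> hit c (relabel_mc f M) \<alpha> n (f t) = hit c M \<alpha> n t"
  using inj by (induction n arbitrary: t) (simp_all add: simps sum.reindex pmf_relabel)

text \<open>The recursion for \<open>hit\<close> commutes with the relabelling, so no transfer of
  path measures is needed.\<close>

lemma prob_reach_relabel: "prob_reach (relabel_mc f M) \<alpha> = prob_reach M \<alpha>"
proof -
  have "mc_init M \<in> mc_states M" using mc by (simp add: markov_chain_def)
  then show ?thesis
    using mc markov_chain_relabel by (simp add: prob_reach_eq_val hit_val_def simps hit_relabel)
qed

lemma sat_every_relabel:
  assumes "M \<Turnstile>\<^sub>o I"
  shows "relabel_mc f M \<Turnstile>\<^sub>a I"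
proof -
  \<comment> \<open>The intervals are respected only at reachable states, so the satisfaction
    relation has to be confined to them.\<close>
  define B where "B = {s. (mc_init M, s) \<in> (step_rel M)\<^sup>*}"
  have B_step: "s' \<in> B" if "s \<in> B" "s' \<in> set_pmf (mc_trans M s)" for s s'
    using that by (auto simp: B_def step_rel_def intro: rtrancl_into_rtrancl)
  have B_sub: "B \<subseteq> mc_states M"
  proof
    fix s assume "s \<in> B"
    then have "(mc_init M, s) \<in> (step_rel M)\<^sup>*" by (simp add: B_def)
    then show "s \<in> mc_states M"
      by induction (use mc in \<open>auto simp: markov_chain_def step_rel_def\<close>)
  qed
  have fin: "finite (mc_states M)" using mc by (simp add: markov_chain_def)
  have states: "imc_states I = mc_states M" and init: "imc_init I = mc_init M"
    using assms by (auto simp: sat_once_def)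
  have init_B: "mc_init M \<in> B" by (simp add: B_def)
  have trans: "pmf (mc_trans M s) s' \<in> imc_trans I s s'" if "s \<in> B" "s' \<in> mc_states M" for s s'
    using assms that B_sub mc_reachable_if_rtrancl[of M s] by (auto simp: sat_once_def B_def)
  \<comment> \<open>A point mass at the preimage of \<open>t'\<close>. It is switched off outside
    \<open>B\<close>, because the support condition concerns all \<open>t'\<close>, whereas
    normalisation is demanded only of successors.\<close>
  define \<delta> where "\<delta> t' s' = (of_bool (t' = f s' \<and> s' \<in> B) :: real)" for t' s'
  have \<delta>_eq: "\<delta> (f u) s' = of_bool (s' = u) * of_bool (u \<in> B)"
    if "u \<in> mc_states M" "s' \<in> mc_states M" for u s'
    using that inj by (auto simp: \<delta>_def dest: inj_onD)
  have dist: "(\<Sum>s'\<in>mc_states M. \<delta> t' s') = 1"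
    if "s \<in> B" "t' \<in> f ` mc_states M" "0 < pmf (map_pmf f (mc_trans M s)) t'" for s t'
  proof -
    from \<open>t' \<in> f ` mc_states M\<close> obtain u where u: "u \<in> mc_states M" "t' = f u" by auto
    then have "u \<in> B"
      using that B_step B_sub by (metis pmf_relabel pmf_eq_0_set_pmf less_irrefl subsetD)
    with u fin show ?thesis by (simp add: \<delta>_eq of_bool_def)
  qed
  have avg: "(\<Sum>t'\<in>f ` mc_states M. pmf (map_pmf f (mc_trans M s)) t' * \<delta> t' s') = pmf (mc_trans M s) s'"
    if "s \<in> B" "s' \<in> mc_states M" for s s'
  proof -
    have "(\<Sum>t'\<in>f ` mc_states M. pmf (map_pmf f (mc_trans M s)) t' * \<delta> t' s') =
        (\<Sum>u\<in>mc_states M. pmf (mc_trans M s) u * (of_bool (s' = u) * of_bool (u \<in> B)))"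
      using inj that B_sub by (auto simp: sum.reindex pmf_relabel \<delta>_eq intro!: sum.cong)
    also have "\<dots> = (\<Sum>u\<in>mc_states M. if u = s' then pmf (mc_trans M s) u * of_bool (u \<in> B) else 0)"
      by (intro sum.cong) auto
    also have "\<dots> = pmf (mc_trans M s) s' * of_bool (s' \<in> B)"
      using fin that by simp
    \<comment> \<open>If \<open>s'\<close> is not in \<open>B\<close>, it is no successor of
      \<open>s\<close>, and both sides are zero.\<close>
    also have "\<dots> = pmf (mc_trans M s) s'"
      using B_step that by (auto simp: pmf_eq_0_set_pmf)
    finally show ?thesis .
  qed
  show ?thesis
    unfolding sat_every_def
  proof (intro exI[of _ "(\<lambda>s. (f s, s)) ` B"] conjI ballI, goal_cases)
    case 1 show ?case using B_sub by (auto simp: simps states)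
  next
    case 2 show ?case using init_B by (auto simp: simps init)
  next
    case (3 x)
    then obtain s where s: "s \<in> B" "x = (f s, s)" by auto
    have "\<delta> \<in> f ` mc_states M \<rightarrow> mc_states M \<rightarrow> {0..1}" by (auto simp: \<delta>_def)
    moreover have "\<forall>t'\<in>f ` mc_states M. \<forall>s'\<in>mc_states M. 0 < \<delta> t' s' \<longrightarrow> (t', s') \<in> (\<lambda>s. (f s, s)) ` B"
      by (auto simp: \<delta>_def)
    ultimately show ?case
      using s B_sub assms dist[OF s(1)] avg[OF s(1)] trans[OF s(1)]
      by (auto simp: simps states sat_once_def subset_iff intro!: bexI[of _ \<delta>])
  qed
qed

end

section \<open>From at-every-step to once-and-for-all\<close>

text \<open>\<open>D t s\<close> is the function \<open>\<delta>\<close> that witnesses the pair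
  \<open>(t, s)\<close>, fixed once for each pair of \<open>R\<close>.\<close>

locale every_step =
  fixes N :: "('t, 'ap) mc" and I :: "('s, 'ap) imc" and A \<alpha> :: "'ap set"
    and R :: "('t \<times> 's) set" and D :: "'t \<Rightarrow> 's \<Rightarrow> 't \<Rightarrow> 's \<Rightarrow> real"
  assumes N: "markov_chain A N" and I: "interval_markov_chain A I"
    and R_sub: "R \<subseteq> mc_states N \<times> imc_states I"
    and R_init: "(mc_init N, imc_init I) \<in> R"
    and R_label: "\<And>t s. (t, s) \<in> R \<Longrightarrow> mc_label N t = imc_label I s"
    and D_nonneg: "\<And>t s t' s'. (t, s) \<in> R \<Longrightarrow> t' \<in> mc_states N \<Longrightarrow> s' \<in> imc_states I \<Longrightarrow> 0 \<le> D t s t' s'"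
    and D_sum: "\<And>t s t'. (t, s) \<in> R \<Longrightarrow> t' \<in> mc_states N \<Longrightarrow> 0 < pmf (mc_trans N t) t' \<Longrightarrow>
      (\<Sum>s'\<in>imc_states I. D t s t' s') = 1"
    and D_trans: "\<And>t s s'. (t, s) \<in> R \<Longrightarrow> s' \<in> imc_states I \<Longrightarrow>
      (\<Sum>t'\<in>mc_states N. pmf (mc_trans N t) t' * D t s t' s') \<in> imc_trans I s s'"
    and D_supp: "\<And>t s t' s'. (t, s) \<in> R \<Longrightarrow> t' \<in> mc_states N \<Longrightarrow> s' \<in> imc_states I \<Longrightarrow>
      0 < D t s t' s' \<Longrightarrow> (t', s') \<in> R"
begin

section \<open>Selectors and the chains they induce\<close>

definition selectors :: "('s \<Rightarrow> 't) set" where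
  "selectors = Pi\<^sub>E (snd ` R) (\<lambda>s. {t. (t, s) \<in> R})"

definition mix :: "('s \<Rightarrow> 't) \<Rightarrow> 's \<Rightarrow> 's \<Rightarrow> real" where
  "mix \<tau> s s' = (\<Sum>t'\<in>mc_states N. pmf (mc_trans N (\<tau> s)) t' * D (\<tau> s) s t' s')"

text \<open>States outside the range of \<open>R\<close> get a self-loop only to make the chain
  total; they are unreachable, so their intervals impose nothing.\<close>

definition select_mc :: "('s \<Rightarrow> 't) \<Rightarrow> ('s, 'ap) mc" where
  "select_mc \<tau> =
     \<lparr>mc_states = imc_states I, mc_init = imc_init I,
      mc_trans = (\<lambda>s. if s \<in> snd ` R then embed_pmf (\<lambda>s'. if s' \<in> imc_states I then mix \<tau> s s' else 0)
        else return_pmf s),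
      mc_label = imc_label I\<rparr>"

lemma fin: "finite (mc_states N)" "finite (imc_states I)" "finite R"
  using N I R_sub by (auto simp: markov_chain_def interval_markov_chain_def intro: finite_subset)

text \<open>Selectors are extensional functions with finite domain and finite fibres. Finiteness is
  what later permits \<open>c\<close> to tend to 1.\<close>

lemma finite_selectors: "finite selectors"
proof -
  have "{t. (t, s) \<in> R} \<subseteq> mc_states N" for s using R_sub by auto
  then show ?thesis
    using fin unfolding selectors_def by (intro finite_PiE) (auto intro: finite_subset)
qed

lemma selector: "\<tau> \<in> selectors \<Longrightarrow> s \<in> snd ` R \<Longrightarrow> (\<tau> s, s) \<in> R"
  by (auto simp: selectors_def PiE_iff)

lemma D_eq_0:
  assumes "(t, s) \<in> R" "t' \<in> mc_states N" "s' \<in> imc_states I" "(t', s') \<notin> R"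
  shows "D t s t' s' = 0"
  using D_nonneg[OF assms(1-3)] D_supp[OF assms(1-3)] assms(4) by force

lemma D_sum_range:
  assumes "(t, s) \<in> R" "t' \<in> mc_states N" "0 < pmf (mc_trans N t) t'"
  shows "(\<Sum>s'\<in>snd ` R. D t s t' s') = 1"
  unfolding D_sum[OF assms, symmetric] using R_sub fin assms D_eq_0[OF assms(1,2)]
  by (intro sum.mono_neutral_left) (auto, force)

text \<open>A draw from \<open>mix\<close> has two stages, a step of \<open>N\<close> and then a
  draw from \<open>D\<close>; the two finite sums are exchanged.\<close>

lemma sum_mix:
  assumes "\<tau> \<in> selectors" "s \<in> snd ` R"
  shows "(\<Sum>s'\<in>snd ` R. mix \<tau> s s' * h s') =
    (\<Sum>t'\<in>mc_states N. pmf (mc_trans N (\<tau> s)) t' * (\<Sum>s'\<in>snd ` R. D (\<tau> s) s t' s' * h s'))"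
  unfolding mix_def sum_distrib_left sum_distrib_right
  by (subst sum.swap) (simp add: mult_ac)

lemma mix_nonneg: "\<tau> \<in> selectors \<Longrightarrow> s \<in> snd ` R \<Longrightarrow> s' \<in> imc_states I \<Longrightarrow> 0 \<le> mix \<tau> s s'"
  unfolding mix_def by (intro sum_nonneg mult_nonneg_nonneg D_nonneg selector) auto

lemma mix_eq_0:
  assumes "\<tau> \<in> selectors" "s \<in> snd ` R" "s' \<in> imc_states I" "s' \<notin> snd ` R"
  shows "mix \<tau> s s' = 0"
  unfolding mix_def using assms D_eq_0[OF selector[OF assms(1,2)] _ assms(3)]
  by (intro sum.neutral) force

lemma sum_mix_eq_1:
  assumes "\<tau> \<in> selectors" "s \<in> snd ` R"
  shows "(\<Sum>s'\<in>snd ` R. mix \<tau> s s') = 1"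
proof -
  note sel = selector[OF assms]
  interpret N: finite_mc N A \<alpha> 1 by unfold_locales (use N in auto)
  \<comment> \<open>\<open>D\<close> is normalised only at successors of \<open>\<tau> s\<close>;
    elsewhere the factor in front is zero.\<close>
  have "pmf (mc_trans N (\<tau> s)) t' * (\<Sum>s'\<in>snd ` R. D (\<tau> s) s t' s') = pmf (mc_trans N (\<tau> s)) t'"
    if "t' \<in> mc_states N" for t'
    using D_sum_range[OF sel that] by (cases "pmf (mc_trans N (\<tau> s)) t' = 0") (auto simp: pmf_pos)
  then have "(\<Sum>t'\<in>mc_states N. pmf (mc_trans N (\<tau> s)) t' * (\<Sum>s'\<in>snd ` R. D (\<tau> s) s t' s')) =
      (\<Sum>t'\<in>mc_states N. pmf (mc_trans N (\<tau> s)) t')"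
    by (rule sum.cong[OF refl])
  then show ?thesis
    using sum_mix[OF assms, of "\<lambda>_. 1"] N.sum_pmf[of "\<tau> s"] sel R_sub by auto
qed

text \<open>\<open>embed_pmf\<close> returns the intended weights because they are nonnegative and
  sum to 1, no mass lying outside the range of \<open>R\<close>.\<close>

lemma pmf_select:
  assumes "\<tau> \<in> selectors" "s \<in> snd ` R"
  shows "pmf (mc_trans (select_mc \<tau>) s) s' = (if s' \<in> imc_states I then mix \<tau> s s' else 0)"
proof -
  let ?h = "\<lambda>s'. if s' \<in> imc_states I then mix \<tau> s s' else 0"
  have "(\<Sum>s'\<in>imc_states I. mix \<tau> s s') = (\<Sum>s'\<in>snd ` R. mix \<tau> s s')"
    using R_sub fin mix_eq_0[OF assms] by (intro sum.mono_neutral_right) auto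
  then have sum: "(\<Sum>s'\<in>imc_states I. mix \<tau> s s') = 1"
    using sum_mix_eq_1[OF assms] by simp
  have "(\<integral>\<^sup>+s'. ennreal (?h s') \<partial>count_space UNIV) = (\<Sum>s'\<in>imc_states I. ennreal (?h s'))"
    using fin by (intro nn_integral_count_space') auto
  also have "\<dots> = 1"
    using mix_nonneg[OF assms] sum by (simp add: sum_ennreal)
  finally show ?thesis
    using assms mix_nonneg[OF assms] by (subst pmf_embed_pmf[symmetric]) (auto simp: select_mc_def)
qed

lemma closed_select:
  assumes "\<tau> \<in> selectors"
  shows "closed_in_mc (select_mc \<tau>) (snd ` R)"
proof -
  have "s' \<in> snd ` R" if "s \<in> snd ` R" "s' \<in> set_pmf (mc_trans (select_mc \<tau>) s)" for s s'
  proof (rule ccontr)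
    assume "s' \<notin> snd ` R"
    then have "pmf (mc_trans (select_mc \<tau>) s) s' = 0"
      using pmf_select[OF assms that(1)] mix_eq_0[OF assms that(1)] by simp
    with that(2) show False by (simp add: pmf_eq_0_set_pmf)
  qed
  then show ?thesis using fin by (auto simp: closed_in_mc_def)
qed

lemma select_simps [simp]:
  "mc_states (select_mc \<tau>) = imc_states I" "mc_init (select_mc \<tau>) = imc_init I"
  "mc_label (select_mc \<tau>) = imc_label I"
  by (simp_all add: select_mc_def)

lemma range_R: "snd ` R \<subseteq> imc_states I" "imc_init I \<in> snd ` R"
  using R_sub R_init by force+

lemma markov_chain_select:
  assumes "\<tau> \<in> selectors"
  shows "markov_chain A (select_mc \<tau>)"
proof -
  have "set_pmf (mc_trans (select_mc \<tau>) s) \<subseteq> imc_states I" if "s \<in> imc_states I" for s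
  proof (cases "s \<in> snd ` R")
    case True
    then show ?thesis using closed_select[OF assms] range_R unfolding closed_in_mc_def by blast
  next
    case False
    then show ?thesis using that by (simp add: select_mc_def)
  qed
  then show ?thesis using I by (auto simp: markov_chain_def interval_markov_chain_def)
qed

text \<open>Reachable states lie in the range of \<open>R\<close>, which is closed, and there the
  averages \<open>mix\<close> meet the intervals by \<open>D_trans\<close>.\<close>

lemma sat_once_select:
  assumes "\<tau> \<in> selectors"
  shows "select_mc \<tau> \<Turnstile>\<^sub>o I"
  unfolding sat_once_def
proof (intro conjI ballI impI)
  fix s s' assume s: "mc_reachable (select_mc \<tau>) s" "s' \<in> imc_states I"
  then have sR: "s \<in> snd ` R"
    using mc_reachable_in_closed[OF _ closed_select[OF assms]] range_R by auto
  then show "pmf (mc_trans (select_mc \<tau>) s) s' \<in> imc_trans I s s'"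
    using s D_trans[OF selector[OF assms sR]] pmf_select[OF assms sR] by (simp add: mix_def)
qed simp_all

section \<open>Comparison of reachability values between \<open>N\<close> and selected
  chains\<close>

text \<open>\<open>D\<close> couples the two steps: it spreads the mass of each successor
  \<open>t'\<close> over states \<open>s'\<close> with \<open>(t', s')\<close> in \<open>R\<close>,
  so \<open>g t'\<close> is at most the average of \<open>h\<close> over them.\<close>

lemma expectation_mono:
  assumes "\<tau> \<in> selectors" "s \<in> snd ` R"
    and le: "\<And>t' s'. (t', s') \<in> R \<Longrightarrow> g t' \<le> h s'"
  shows "(\<Sum>t'\<in>mc_states N. pmf (mc_trans N (\<tau> s)) t' * g t') \<le>
    (\<Sum>s'\<in>snd ` R. pmf (mc_trans (select_mc \<tau>) s) s' * h s')"
proof -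
  note sel = selector[OF assms(1,2)]
  have "pmf (mc_trans N (\<tau> s)) t' * g t' \<le>
      pmf (mc_trans N (\<tau> s)) t' * (\<Sum>s'\<in>snd ` R. D (\<tau> s) s t' s' * h s')"
    if t': "t' \<in> mc_states N" for t'
  proof (cases "pmf (mc_trans N (\<tau> s)) t' = 0")
    case False
    then have "g t' = (\<Sum>s'\<in>snd ` R. D (\<tau> s) s t' s' * g t')"
      using D_sum_range[OF sel t'] by (simp add: pmf_pos flip: sum_distrib_right)
    also have "\<dots> \<le> (\<Sum>s'\<in>snd ` R. D (\<tau> s) s t' s' * h s')"
    proof (rule sum_mono)
      fix s' assume "s' \<in> snd ` R"
      then have s': "s' \<in> imc_states I" using range_R by auto
      show "D (\<tau> s) s t' s' * g t' \<le> D (\<tau> s) s t' s' * h s'"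
        using D_nonneg[OF sel t' s'] D_eq_0[OF sel t' s'] le[of t' s']
        by (cases "(t', s') \<in> R") (auto intro: mult_left_mono)
    qed
    finally show ?thesis by (intro mult_left_mono) auto
  qed simp
  then have "(\<Sum>t'\<in>mc_states N. pmf (mc_trans N (\<tau> s)) t' * g t') \<le> (\<Sum>s'\<in>snd ` R. mix \<tau> s s' * h s')"
    unfolding sum_mix[OF assms(1,2)] by (rule sum_mono)
  also have "\<dots> = (\<Sum>s'\<in>snd ` R. pmf (mc_trans (select_mc \<tau>) s) s' * h s')"
    using range_R by (intro sum.cong) (auto simp: pmf_select[OF assms(1,2)])
  finally show ?thesis .
qed

lemma expectation_mono_rev:
  assumes "\<tau> \<in> selectors" "s \<in> snd ` R"
    and le: "\<And>t' s'. (t', s') \<in> R \<Longrightarrow> h s' \<le> g t'"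
  shows "(\<Sum>s'\<in>snd ` R. pmf (mc_trans (select_mc \<tau>) s) s' * h s') \<le>
    (\<Sum>t'\<in>mc_states N. pmf (mc_trans N (\<tau> s)) t' * g t')"
  using expectation_mono[OF assms(1,2), of "\<lambda>t. - g t" "\<lambda>s. - h s"] le by (simp add: sum_negf)

text \<open>Each fibre of \<open>R\<close> is finite and nonempty, so \<open>v\<close> has a
  minimiser on it. Maximal selectors arise from \<open>- v\<close>.\<close>

lemma minimal_selector:
  obtains \<tau> where "\<tau> \<in> selectors" "\<And>t s. (t, s) \<in> R \<Longrightarrow> (v (\<tau> s) :: real) \<le> v t"
proof -
  have "\<exists>t. (t, s) \<in> R \<and> (\<forall>t'. (t', s) \<in> R \<longrightarrow> v t \<le> v t')" if "s \<in> snd ` R" for s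
  proof -
    have "finite {t. (t, s) \<in> R}"
      using R_sub fin by (auto intro: finite_subset[of _ "mc_states N"])
    moreover have "{t. (t, s) \<in> R} \<noteq> {}" using that by auto
    ultimately obtain t where "is_arg_min v (\<lambda>t. t \<in> {t. (t, s) \<in> R}) t"
      using ex_is_arg_min_if_finite by blast
    then show ?thesis by (auto simp: is_arg_min_linorder)
  qed
  then obtain \<tau> where \<tau>: "\<And>s. s \<in> snd ` R \<Longrightarrow> (\<tau> s, s) \<in> R \<and> (\<forall>t'. (t', s) \<in> R \<longrightarrow> v (\<tau> s) \<le> v t')"
    by metis
  show thesis
  proof (rule that[of "restrict \<tau> (snd ` R)"])
    show "restrict \<tau> (snd ` R) \<in> selectors" using \<tau> by (auto simp: selectors_def)
  next
    fix t s assume ts: "(t, s) \<in> R"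
    then have "s \<in> snd ` R" by force
    with \<tau> ts show "v (restrict \<tau> (snd ` R) s) \<le> v t" by auto
  qed
qed

text \<open>For a selector minimising the value of \<open>N\<close>, the map from \<open>s\<close>
  to the value at \<open>\<tau> s\<close> is a pre-fixed point for the selected chain: replacing
  successors \<open>t'\<close> by \<open>\<tau> s'\<close> can only lower the average.\<close>

lemma ex_select_le: "\<exists>\<tau>\<in>selectors. prob_reach (select_mc \<tau>) \<alpha> \<le> prob_reach N \<alpha>"
proof -
  interpret N: finite_mc N A \<alpha> 1 by unfold_locales (use N in auto)
  let ?v = "hit_val 1 N \<alpha>"
  obtain \<tau> where \<tau>: "\<tau> \<in> selectors" and min: "\<And>t s. (t, s) \<in> R \<Longrightarrow> ?v (\<tau> s) \<le> ?v t"
    using minimal_selector by blast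
  interpret M: finite_mc "select_mc \<tau>" A \<alpha> 1
    by unfold_locales (use markov_chain_select[OF \<tau>] in auto)
  have state: "\<tau> s \<in> mc_states N" and lab: "mc_label N (\<tau> s) = imc_label I s" if "s \<in> snd ` R" for s
    using selector[OF \<tau> that] R_sub R_label by auto
  have "hit_val 1 (select_mc \<tau>) \<alpha> (imc_init I) \<le> ?v (\<tau> (imc_init I))"
  proof (rule M.val_le_pre_fixed_point[OF closed_select[OF \<tau>]])
    fix s assume s: "s \<in> snd ` R"
    show "0 \<le> ?v (\<tau> s)" by (rule N.val_nonneg[OF state[OF s]])
    show "1 \<le> ?v (\<tau> s)" if "mc_label (select_mc \<tau>) s = \<alpha>"
      using that lab[OF s] by (subst N.val_fixed_point[OF state[OF s]]) simp
    assume "mc_label (select_mc \<tau>) s \<noteq> \<alpha>"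
    then have "?v (\<tau> s) = (\<Sum>t'\<in>mc_states N. pmf (mc_trans N (\<tau> s)) t' * ?v t')"
      using lab[OF s] by (subst N.val_fixed_point[OF state[OF s]]) simp
    then show "1 * (\<Sum>s'\<in>snd ` R. pmf (mc_trans (select_mc \<tau>) s) s' * ?v (\<tau> s')) \<le> ?v (\<tau> s)"
      using expectation_mono_rev[OF \<tau> s, of "\<lambda>s. ?v (\<tau> s)" ?v] min by simp
  qed (use range_R in auto)
  also have "\<dots> \<le> ?v (mc_init N)" by (rule min[OF R_init])
  finally show ?thesis
    using \<tau> by (auto simp: prob_reach_eq_val[OF N] prob_reach_eq_val[OF M.mc] intro!: bexI[of _ \<tau>])
qed

text \<open>Dually, a maximising selector yields a post-fixed point, which bounds the value from
  below because \<open>c < 1\<close>.\<close>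

lemma ex_select_ge_discounted:
  assumes c: "0 \<le> c" "c < 1"
  shows "\<exists>\<tau>\<in>selectors. hit_val c N \<alpha> (mc_init N) \<le> prob_reach (select_mc \<tau>) \<alpha>"
proof -
  interpret N: finite_mc N A \<alpha> c by unfold_locales (use N c in auto)
  let ?v = "hit_val c N \<alpha>"
  obtain \<tau> where \<tau>: "\<tau> \<in> selectors" and max: "\<And>t s. (t, s) \<in> R \<Longrightarrow> - ?v (\<tau> s) \<le> - ?v t"
    using minimal_selector[of "\<lambda>t. - ?v t"] by blast
  interpret M: finite_mc "select_mc \<tau>" A \<alpha> c
    by unfold_locales (use markov_chain_select[OF \<tau>] c in auto)
  have state: "\<tau> s \<in> mc_states N" and lab: "mc_label N (\<tau> s) = imc_label I s" if "s \<in> snd ` R" for s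
    using selector[OF \<tau> that] R_sub R_label by auto
  have "?v (mc_init N) \<le> ?v (\<tau> (imc_init I))" using max[OF R_init] by simp
  also have "\<dots> \<le> hit_val c (select_mc \<tau>) \<alpha> (imc_init I)"
  proof (rule M.val_ge_post_fixed_point[OF closed_select[OF \<tau>]])
    fix s assume s: "s \<in> snd ` R"
    show "?v (\<tau> s) \<le> 1" by (rule N.val_le_1[OF state[OF s]])
    assume "mc_label (select_mc \<tau>) s \<noteq> \<alpha>"
    then have "?v (\<tau> s) = c * (\<Sum>t'\<in>mc_states N. pmf (mc_trans N (\<tau> s)) t' * ?v t')"
      using lab[OF s] by (subst N.val_fixed_point[OF state[OF s]]) simp
    also have "\<dots> \<le> c * (\<Sum>s'\<in>snd ` R. pmf (mc_trans (select_mc \<tau>) s) s' * ?v (\<tau> s'))"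
      using expectation_mono[OF \<tau> s, of ?v "\<lambda>s. ?v (\<tau> s)"] max c by (intro mult_left_mono) auto
    finally show "?v (\<tau> s) \<le> c * (\<Sum>s'\<in>snd ` R. pmf (mc_trans (select_mc \<tau>) s) s' * ?v (\<tau> s'))" .
  qed (use range_R c in auto)
  \<comment> \<open>Dropping the discount on the selected chain can only increase its value; the
    discount remains on the side of \<open>N\<close>.\<close>
  also have "\<dots> \<le> prob_reach (select_mc \<tau>) \<alpha>"
    using M.val_discount_le range_R by (auto simp: prob_reach_eq_val[OF M.mc])
  finally show ?thesis using \<tau> by blast
qed

text \<open>Otherwise the maximum \<open>m\<close> over the finitely many selectors lies strictly
  below the probability for \<open>N\<close>, and some discounted value of \<open>N\<close> still
  exceeds \<open>m\<close>.\<close>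

lemma ex_select_ge: "\<exists>\<tau>\<in>selectors. prob_reach N \<alpha> \<le> prob_reach (select_mc \<tau>) \<alpha>"
proof (rule ccontr)
  assume "\<not> ?thesis"
  then have less: "prob_reach (select_mc \<tau>) \<alpha> < prob_reach N \<alpha>" if "\<tau> \<in> selectors" for \<tau>
    using that by auto
  define m where "m = Max ((\<lambda>\<tau>. prob_reach (select_mc \<tau>) \<alpha>) ` selectors)"
  have "selectors \<noteq> {}" using ex_select_le by auto
  then have m: "m < prob_reach N \<alpha>" and m_ge: "\<And>\<tau>. \<tau> \<in> selectors \<Longrightarrow> prob_reach (select_mc \<tau>) \<alpha> \<le> m"
    using finite_selectors less by (auto simp: m_def)
  have init: "mc_init N \<in> mc_states N" using N by (simp add: markov_chain_def)
  interpret one: finite_mc N A \<alpha> 1 by unfold_locales (use N in auto)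
  have "m < hit_val 1 N \<alpha> (mc_init N)" using m N by (simp add: prob_reach_eq_val)
  then obtain n where n: "m < hit 1 N \<alpha> n (mc_init N)"
    using order_tendstoD(1)[OF one.hit_tendsto[OF init]] by (meson eventually_happens sequentially_bot)
  \<comment> \<open>With \<open>n\<close> fixed the lower bound is a monomial in \<open>c\<close>,
    so continuity at 1 suffices and no exchange of limits is required.\<close>
  have "((\<lambda>c. c ^ n * hit 1 N \<alpha> n (mc_init N)) \<longlongrightarrow> 1 ^ n * hit 1 N \<alpha> n (mc_init N)) (at_left 1)"
    by (intro tendsto_intros)
  then have "eventually (\<lambda>c. m < c ^ n * hit 1 N \<alpha> n (mc_init N)) (at_left 1)"
    using n by (intro order_tendstoD(1)) auto
  moreover have "eventually (\<lambda>c. c \<in> {0<..<1}) (at_left (1::real))"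
    by (rule eventually_at_leftI[of 0]) auto
  ultimately have "eventually (\<lambda>c. m < c ^ n * hit 1 N \<alpha> n (mc_init N) \<and> c \<in> {0<..<1}) (at_left 1)"
    by (rule eventually_conj)
  then obtain c where c: "m < c ^ n * hit 1 N \<alpha> n (mc_init N)" "0 < c" "c < 1"
    using eventually_happens'[OF trivial_limit_at_left_real] by auto
  interpret N: finite_mc N A \<alpha> c by unfold_locales (use N c in auto)
  obtain \<tau> where \<tau>: "\<tau> \<in> selectors" "hit_val c N \<alpha> (mc_init N) \<le> prob_reach (select_mc \<tau>) \<alpha>"
    using ex_select_ge_discounted[of c] c by auto
  show False
    using c(1) N.hit_discount[OF init, of n] N.hit_le_val[OF init, of n] \<tau> m_ge[OF \<tau>(1)] by linarith
qed

end

section \<open>The equivalence of the two semantics\<close>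

lemma sat_every_imp_every_step:
  assumes "markov_chain A N" "interval_markov_chain A I" "N \<Turnstile>\<^sub>a I"
  obtains R D where "every_step N I A R D"
proof -
  obtain R where R: "R \<subseteq> mc_states N \<times> imc_states I" "(mc_init N, imc_init I) \<in> R"
    and step: "\<forall>(t, s)\<in>R.
           mc_label N t = imc_label I s \<and>
           (\<exists>\<delta> \<in> mc_states N \<rightarrow> imc_states I \<rightarrow> {0..1::real}.
              (\<forall>t'\<in>mc_states N. pmf (mc_trans N t) t' > 0 \<longrightarrow>
                 (\<Sum>s'\<in>imc_states I. \<delta> t' s') = 1) \<and>
              (\<forall>s'\<in>imc_states I.
                 (\<Sum>t'\<in>mc_states N. pmf (mc_trans N t) t' * \<delta> t' s') \<in> imc_trans I s s') \<and>
              (\<forall>t'\<in>mc_states N. \<forall>s'\<in>imc_states I. \<delta> t' s' > 0 \<longrightarrow> (t', s') \<in> R))"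
    using assms(3) unfolding sat_every_def by blast
  \<comment> \<open>Naming the condition on \<open>\<delta>\<close> lets the choice of one
    \<open>\<delta>\<close> for each pair be made in a single step.\<close>
  define good where "good t s \<delta> \<longleftrightarrow> \<delta> \<in> mc_states N \<rightarrow> imc_states I \<rightarrow> {0..1::real} \<and>
              (\<forall>t'\<in>mc_states N. pmf (mc_trans N t) t' > 0 \<longrightarrow>
                 (\<Sum>s'\<in>imc_states I. \<delta> t' s') = 1) \<and>
              (\<forall>s'\<in>imc_states I.
                 (\<Sum>t'\<in>mc_states N. pmf (mc_trans N t) t' * \<delta> t' s') \<in> imc_trans I s s') \<and>
              (\<forall>t'\<in>mc_states N. \<forall>s'\<in>imc_states I. \<delta> t' s' > 0 \<longrightarrow> (t', s') \<in> R)" for t s \<delta>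
  have "\<exists>\<delta>. good t s \<delta>" if "(t, s) \<in> R" for t s
    using step that unfolding good_def by blast
  then obtain D where D: "\<And>t s. (t, s) \<in> R \<Longrightarrow> good t s (D t s)" by metis
  have label: "mc_label N t = imc_label I s" if "(t, s) \<in> R" for t s
    using step that by blast
  have "every_step N I A R D"
    using assms(1,2) R label by unfold_locales (use D[unfolded good_def] in \<open>auto simp: Pi_iff\<close>)
  then show thesis by (rule that)
qed

theorem theorem1:
  fixes A :: "'ap set" and I :: "('s, 'ap) imc" and \<alpha> :: "'ap set"
    and cmp :: "real \<Rightarrow> real \<Rightarrow> bool" and p :: real
  assumes "interval_markov_chain A I"
    and "\<alpha> \<subseteq> A"
    and "cmp \<in> {(\<le>), (<), (>), (\<ge>)}"
    and "0 < p" and "p < 1"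
  shows "(\<exists>M :: ('s, 'ap) mc. markov_chain A M \<and> M \<Turnstile>\<^sub>o I \<and> cmp (prob_reach M \<alpha>) p) \<longleftrightarrow>
         (\<exists>M :: ('t::infinite, 'ap) mc. markov_chain A M \<and> M \<Turnstile>\<^sub>a I \<and> cmp (prob_reach M \<alpha>) p)"
proof
  assume "\<exists>M :: ('s, 'ap) mc. markov_chain A M \<and> M \<Turnstile>\<^sub>o I \<and> cmp (prob_reach M \<alpha>) p"
  then obtain M :: "('s, 'ap) mc" where M: "markov_chain A M" "M \<Turnstile>\<^sub>o I" "cmp (prob_reach M \<alpha>) p"
    by blast
  have "finite (mc_states M)" using M(1) by (simp add: markov_chain_def)
  \<comment> \<open>The infinite type has room for a copy of the finite state set.\<close>
  then obtain T :: "'t set" where "finite T" "card T = card (mc_states M)"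
    using infinite_arbitrarily_large[OF infinite_UNIV] by metis
  with \<open>finite (mc_states M)\<close> obtain f :: "'s \<Rightarrow> 't" where "bij_betw f (mc_states M) T"
    using finite_same_card_bij by metis
  then interpret relabelling M f A
    by unfold_locales (use M in \<open>auto simp: bij_betw_def\<close>)
  show "\<exists>M :: ('t, 'ap) mc. markov_chain A M \<and> M \<Turnstile>\<^sub>a I \<and> cmp (prob_reach M \<alpha>) p"
    using markov_chain_relabel sat_every_relabel[OF M(2)] M(3) prob_reach_relabel by metis
next
  assume "\<exists>M :: ('t, 'ap) mc. markov_chain A M \<and> M \<Turnstile>\<^sub>a I \<and> cmp (prob_reach M \<alpha>) p"
  then obtain K :: "('t, 'ap) mc" where K: "markov_chain A K" "K \<Turnstile>\<^sub>a I" "cmp (prob_reach K \<alpha>) p"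
    by blast
  obtain R D where "every_step K I A R D"
    using sat_every_imp_every_step[OF K(1) assms(1) K(2)] .
  then interpret every_step K I A \<alpha> R D .
  \<comment> \<open>For the upper bounds on the probability \<open>ex_select_le\<close> supplies the
    selector, for the lower bounds \<open>ex_select_ge\<close>; transitivity does the rest.\<close>
  have "\<exists>\<tau>\<in>selectors. cmp (prob_reach (select_mc \<tau>) \<alpha>) p"
    using assms(3) K(3) ex_select_le ex_select_ge by (auto intro: order_trans le_less_trans less_le_trans)
  then show "\<exists>M :: ('s, 'ap) mc. markov_chain A M \<and> M \<Turnstile>\<^sub>o I \<and> cmp (prob_reach M \<alpha>) p"
    using markov_chain_select sat_once_select by blast
qed

end
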